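(* Let $X$ be a normed space, $Y$ a Banach space, and let $T,S\in LR(X,Y)$ satisfy $D(T)\subset D(S)$ and $S(0)\subset T(0)$. If $S$ is $T$-bounded with $T$-bound less than $1$, then $T+S$ is closed (closable) if and only if $T$ is closed (closable). Moreover, $D(\overline{T+S})=D(\overline T)$.
   Context: All spaces are over the same scalar field ($\mathbf R$ or $\mathbf C$). $LR(X,Y)$ is the set of all linear subspaces of $X\times Y$. For $T,S\in LR(X,Y)$: $D(T)$ is the domain of $T$, $T(x)=\{y\in Y:(x,y)\in T\}$, and $T+S=\{(x,y+z):(x,y)\in T,\ (x,z)\in S\}$. $\overline T$ is the closure of $T$ in $X\times Y$; $T$ is closed if $\overline T=T$, and closable if $\overline T(x)=T(x)$ for each $x\in D(T)$. For $x\in D(T)$, $\|T(x)\|:=\|[y]\|$ for any $y\in T(x)$, where $[y]=y+\overline{T(0)}\in Y/\overline{T(0)}$ and $\|[y]\|=\inf\{\|y-e\|:e\in\overline{T(0)}\}$ (likewise for $S$). $S$ is $T$-bounded if $D(T)\subset D(S)$ and there is $c\ge0$ with $\|S(x)\|\le c(\|x\|+\|T(x)\|)$ for all $x\in D(T)$. If $S$ is $T$-bounded, the $T$-bound of $S$ is the infimum of all $b\ge0$ for which there is $a\ge0$ with $\|S(x)\|\le a\|x\|+b\|T(x)\|$ for all $x\in D(T)$. *)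

theory Defs
  imports "HOL-Analysis.Analysis"
begin

text \<open>
  Normed spaces over a scalar field that is either the reals or the complex numbers.  The library
  has type classes for real normed spaces only, so the multiplication by scalars is a parameter.
  The norm and topology come from the underlying real normed space, whose scalar multiplication
  has to be the restriction of \<open>scale\<close>.
  The class \<open>real_normed_field\<close> (whose norm is multiplicative) contains \<open>real\<close> and \<open>complex\<close> and,
  by the Gelfand-Mazur theorem, nothing else up to isometric isomorphism.
\<close>

locale normed_space_over = vector_space scale
  for scale :: "'k::real_normed_field \<Rightarrow> 'a::real_normed_vector \<Rightarrow> 'a" +
  assumes norm_scale: "norm (scale c x) = norm c * norm x"
    and scale_of_real: "scale (of_real r) x = r *\<^sub>R x"

lemma normed_space_over_real:
  "normed_space_over ((*\<^sub>R) :: real \<Rightarrow> 'a \<Rightarrow> 'a::real_normed_vector)"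
  by unfold_locales (auto simp: scaleR_add_right scaleR_add_left)

lemma normed_space_over_complex:
  "normed_space_over ((*) :: complex \<Rightarrow> complex \<Rightarrow> complex)"
  by unfold_locales (auto simp: algebra_simps norm_mult scaleR_conv_of_real)

definition LR ::
  "('k::field \<Rightarrow> 'a::ab_group_add \<Rightarrow> 'a) \<Rightarrow> ('k \<Rightarrow> 'b::ab_group_add \<Rightarrow> 'b) \<Rightarrow> ('a \<times> 'b) set set"
  where "LR sX sY = {T. module.subspace (module_prod.scale sX sY) T}"

text \<open>The domain \<open>D(T)\<close> is \<open>Domain T\<close>, and \<open>T(x)\<close> is the relational image \<open>T `` {x}\<close>.\<close>

definition rel_plus :: "('a \<times> 'b) set \<Rightarrow> ('a \<times> 'b) set \<Rightarrow> ('a \<times> 'b::plus) set"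
  where "rel_plus T S = {(x, y + z) | x y z. (x, y) \<in> T \<and> (x, z) \<in> S}"

definition closable :: "('a::topological_space \<times> 'b::topological_space) set \<Rightarrow> bool"
  where "closable T \<longleftrightarrow> (\<forall>x\<in>Domain T. closure T `` {x} = T `` {x})"

text \<open>The norm of the coset \<open>y + N\<close> in the quotient by \<open>N\<close>.\<close>

definition quot_norm :: "'b::real_normed_vector set \<Rightarrow> 'b \<Rightarrow> real"
  where "quot_norm N y = Inf {norm (y - e) | e. e \<in> N}"

text \<open>Meaningful for \<open>x \<in> Domain T\<close>; the choice of \<open>y\<close> is immaterial, see \<open>rel_norm_eq\<close> below.\<close>

definition rel_norm :: "('a::zero \<times> 'b::real_normed_vector) set \<Rightarrow> 'a \<Rightarrow> real"
  where "rel_norm T x = quot_norm (closure (T `` {0})) (SOME y. y \<in> T `` {x})"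

definition rel_bounded ::
  "('a::real_normed_vector \<times> 'b::real_normed_vector) set \<Rightarrow> ('a \<times> 'b) set \<Rightarrow> bool"
  where "rel_bounded T S \<longleftrightarrow> Domain T \<subseteq> Domain S \<and>
    (\<exists>c\<ge>0. \<forall>x\<in>Domain T. rel_norm S x \<le> c * (norm x + rel_norm T x))"

text \<open>If \<open>rel_bounded T S\<close>, the set below is nonempty, so that \<open>Inf\<close> is the genuine infimum.\<close>

definition rel_bound ::
  "('a::real_normed_vector \<times> 'b::real_normed_vector) set \<Rightarrow> ('a \<times> 'b) set \<Rightarrow> real"
  where "rel_bound T S = Inf {b. b \<ge> 0 \<and>
    (\<exists>a\<ge>0. \<forall>x\<in>Domain T. rel_norm S x \<le> a * norm x + b * rel_norm T x)}"

lemma rel_norm_eq: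
  fixes sX :: "'k::real_normed_field \<Rightarrow> 'a::real_normed_vector \<Rightarrow> 'a"
    and sY :: "'k \<Rightarrow> 'b::real_normed_vector \<Rightarrow> 'b"
  assumes "normed_space_over sX" "normed_space_over sY"
    and T: "T \<in> LR sX sY" and y: "y \<in> T `` {x}"
  shows "rel_norm T x = quot_norm (closure (T `` {0})) y"
proof -
  interpret X: normed_space_over sX by fact
  interpret Y: normed_space_over sY by fact
  interpret module_prod sX sY by unfold_locales
  have sub: "p.subspace T" using T by (simp add: LR_def)
  define N where "N = T `` {0}"
  have N_add: "u + v \<in> N" if "u \<in> N" "v \<in> N" for u v
    using p.subspace_add[OF sub, of "(0,u)" "(0,v)"] that by (simp add: N_def)
  have N_minus: "- u \<in> N" if "u \<in> N" for u
    using p.subspace_neg[OF sub, of "(0,u)"] that by (simp add: N_def)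
  have shift: "e + d \<in> closure N" if "e \<in> closure N" "d \<in> N" for e d
  proof -
    obtain f where f: "\<And>n. f n \<in> N" "f \<longlonglongrightarrow> e"
      using \<open>e \<in> closure N\<close> by (auto simp: closure_sequential)
    have "(\<lambda>n. f n + d) \<longlonglongrightarrow> e + d" using f(2) by (intro tendsto_intros)
    moreover have "f n + d \<in> N" for n using f(1) that(2) by (rule N_add)
    ultimately show ?thesis unfolding closure_sequential
      by (intro exI[of _ "\<lambda>n. f n + d"]) auto
  qed
  have le: "{norm (u - e) | e. e \<in> closure N} \<subseteq> {norm (v - e) | e. e \<in> closure N}"
    if "v - u \<in> N" for u v
  proof
    fix r assume "r \<in> {norm (u - e) | e. e \<in> closure N}"
    then obtain e where e: "e \<in> closure N" "r = norm (u - e)" by auto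
    have "r = norm (v - (e + (v - u)))" using e(2) by (simp add: algebra_simps)
    then show "r \<in> {norm (v - e) | e. e \<in> closure N}" using shift[OF e(1) that] by blast
  qed
  define z where "z = (SOME y. y \<in> T `` {x})"
  have z: "z \<in> T `` {x}" unfolding z_def using y by (rule someI)
  have "(x, z) - (x, y) \<in> T" using p.subspace_diff[OF sub] y z by blast
  then have zy: "z - y \<in> N" by (simp add: N_def)
  then have "y - z \<in> N" using N_minus[of "z - y"] by simp
  with zy have "quot_norm (closure N) z = quot_norm (closure N) y"
    unfolding quot_norm_def using le[of y z] le[of z y] by (simp add: subset_antisym)
  then show ?thesis by (simp add: rel_norm_def z_def N_def)
qed

end

theory Submission
  imports Defs
begin

text \<open>
  The relations \<open>T\<close> and \<open>T + S\<close> have the same domain and, because \<open>S(0) \<subseteq> T(0)\<close>, the same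
  multivalued part \<open>V = T(0)\<close>.  Modulo \<open>V\<close> they are single-valued.  If
  \<open>\<parallel>S(x)\<parallel> \<le> a \<parallel>x\<parallel> + b \<parallel>T(x)\<parallel>\<close> with \<open>b < 1\<close>, then the triangle inequality shows
  \<open>\<parallel>(T+S)(x)\<parallel> \<le> a \<parallel>x\<parallel> + (1 + b) \<parallel>T(x)\<parallel>\<close> and
  \<open>(1 - b) \<parallel>T(x)\<parallel> \<le> a \<parallel>x\<parallel> + \<parallel>(T+S)(x)\<parallel>\<close>, so the graph norms of \<open>T\<close> and \<open>T + S\<close> modulo \<open>V\<close>
  are equivalent.  The two relations now play symmetric roles, and everything follows from this
  equivalence (\<open>graph_dominates\<close> in both directions).

  If \<open>Q\<close> is dominated by \<open>P\<close>, a convergent sequence in \<open>P\<close> yields a sequence in \<open>Q\<close> over the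
  same first components whose second components are Cauchy modulo \<open>V\<close>.  Since \<open>Y\<close> is complete,
  representatives can be chosen to converge (\<open>graph_dominates_lift\<close>), which gives
  \<open>D(closure P) \<subseteq> D(closure Q)\<close>.  If moreover \<open>P\<close> is dominated by \<open>Q\<close> and the limit lies over
  \<open>0\<close>, closability of \<open>Q\<close> forces the limit in \<open>Q\<close> into \<open>V\<close>, and domination forces the
  limit in \<open>P\<close> into \<open>closure V = V\<close>; so \<open>P\<close> is closable.  Closedness is closability together with
  \<open>D(closure T) = D(T)\<close>, so its equivalence is a consequence of the other two claims.
\<close>

section \<open>The distance to a subspace as a seminorm\<close>

lemma infdist_greatest:
  assumes "V \<noteq> {}" and "\<And>e. e \<in> V \<Longrightarrow> c \<le> dist y e"
  shows "c \<le> infdist y V"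
  using assms by (auto simp: infdist_notempty intro: cINF_greatest)

lemma infdist_subspace_shift:
  assumes V: "subspace V" and v: "v \<in> V"
  shows "infdist (y + v) V = infdist (y :: 'b::real_normed_vector) V"
proof -
  have le: "infdist (u + w) V \<le> infdist u V" if "w \<in> V" for u w
  proof -
    have "infdist (u + w) V \<le> dist u e" if "e \<in> V" for e
    proof -
      have "infdist (u + w) V \<le> dist (u + w) (e + w)"
        using V \<open>w \<in> V\<close> that by (intro infdist_le subspace_add)
      then show ?thesis by simp
    qed
    then show ?thesis using subspace_0[OF V] by (intro infdist_greatest) auto
  qed
  show ?thesis
    using le[of v y] le[of "- v" "y + v"] v subspace_neg[OF V v] by simp
qed

lemma infdist_subspace_cong:
  assumes "subspace V" and "y - z \<in> V"
  shows "infdist y V = infdist (z :: 'b::real_normed_vector) V"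
  using infdist_subspace_shift[OF assms, of z] by simp

lemma infdist_subspace_le_norm:
  assumes "subspace V"
  shows "infdist y V \<le> norm (y :: 'b::real_normed_vector)"
  using infdist_le[OF subspace_0[OF assms], of y] by simp

lemma infdist_subspace_add:
  assumes V: "subspace V"
  shows "infdist (y + z) V \<le> infdist y V + infdist (z :: 'b::real_normed_vector) V"
proof -
  have "infdist (y + z) V - infdist y V \<le> dist z e" if e: "e \<in> V" for e
  proof -
    have "infdist (y + z) V = infdist (y + (z - e)) V"
      using e by (intro infdist_subspace_cong[OF V]) simp
    also have "\<dots> \<le> infdist y V + dist (y + (z - e)) y" by (rule infdist_triangle)
    finally show ?thesis by (simp add: dist_norm)
  qed
  then have "infdist (y + z) V - infdist y V \<le> infdist z V"
    using subspace_0[OF V] by (intro infdist_greatest) auto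
  then show ?thesis by simp
qed

lemma infdist_subspace_minus:
  assumes V: "subspace V"
  shows "infdist (- y) V = infdist (y :: 'b::real_normed_vector) V"
proof -
  have le: "infdist (- u) V \<le> infdist u V" for u
  proof (rule infdist_greatest)
    show "V \<noteq> {}" using subspace_0[OF V] by blast
    fix e assume "e \<in> V"
    then have "infdist (- u) V \<le> dist (- u) (- e)" using V by (intro infdist_le subspace_neg)
    then show "infdist (- u) V \<le> dist u e" by (simp add: dist_minus)
  qed
  show ?thesis using le[of y] le[of "- y"] by simp
qed

lemma infdist_approx:
  assumes "infdist y V < r" and "V \<noteq> {}"
  obtains v where "v \<in> V" "dist y v < r"
  using assms by (auto simp: infdist_notempty cINF_less_iff)

section \<open>Linear relations\<close>

text \<open>
  Restriction of scalars to the reals, so that the theory of real normed spaces applies.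
\<close>

lemma LR_subspace:
  assumes "normed_space_over sX" and "normed_space_over sY" and "T \<in> LR sX sY"
  shows "subspace T"
proof -
  interpret X: normed_space_over sX by fact
  interpret Y: normed_space_over sY by fact
  interpret module_prod sX sY by unfold_locales
  have T: "p.subspace T" using assms(3) by (simp add: LR_def)
  have "r *\<^sub>R u \<in> T" if "u \<in> T" for r u
    using p.subspace_scale[OF T that, of "of_real r"]
    by (cases u) (simp add: scale_def X.scale_of_real Y.scale_of_real)
  then show ?thesis
    using p.subspace_0[OF T] p.subspace_add[OF T] by (auto simp: subspace_def zero_prod_def)
qed

lemma subspace_Image_0:
  assumes T: "subspace T"
  shows "subspace (T `` {0})"
proof (rule subspaceI)
  show "0 \<in> T `` {0}" using subspace_0[OF T] by (simp add: zero_prod_def)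
  show "x + y \<in> T `` {0}" if "x \<in> T `` {0}" "y \<in> T `` {0}" for x y
    using subspace_add[OF T, of "(0, x)" "(0, y)"] that by simp
  show "c *\<^sub>R x \<in> T `` {0}" if "x \<in> T `` {0}" for c x
    using subspace_scale[OF T, of "(0, x)" c] that by simp
qed

lemma subspace_Image_diff:
  assumes "subspace T" and "(x, y) \<in> T" and "(x, z) \<in> T"
  shows "y - z \<in> T `` {0}"
  using subspace_diff[OF assms] by simp

lemma subspace_rel_plus:
  fixes T S :: "('a::real_vector \<times> 'b::real_vector) set"
  assumes T: "subspace T" and S: "subspace S"
  shows "subspace (rel_plus T S)"
proof (rule subspaceI)
  show "0 \<in> rel_plus T S"
    using subspace_0[OF T] subspace_0[OF S] by (force simp: rel_plus_def zero_prod_def)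
next
  fix u v assume "u \<in> rel_plus T S" "v \<in> rel_plus T S"
  then obtain x y z x' y' z' where
    u: "u = (x, y + z)" "(x, y) \<in> T" "(x, z) \<in> S" and
    v: "v = (x', y' + z')" "(x', y') \<in> T" "(x', z') \<in> S"
    unfolding rel_plus_def by blast
  have "(x + x', y + y') \<in> T" "(x + x', z + z') \<in> S"
    using subspace_add[OF T u(2) v(2)] subspace_add[OF S u(3) v(3)] by simp_all
  moreover have "u + v = (x + x', (y + y') + (z + z'))" using u v by simp
  ultimately show "u + v \<in> rel_plus T S" unfolding rel_plus_def by blast
next
  fix c u assume "u \<in> rel_plus T S"
  then obtain x y z where u: "u = (x, y + z)" "(x, y) \<in> T" "(x, z) \<in> S"
    unfolding rel_plus_def by blast
  have "(c *\<^sub>R x, c *\<^sub>R y) \<in> T" "(c *\<^sub>R x, c *\<^sub>R z) \<in> S"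
    using subspace_scale[OF T u(2)] subspace_scale[OF S u(3)] by simp_all
  moreover have "c *\<^sub>R u = (c *\<^sub>R x, c *\<^sub>R y + c *\<^sub>R z)"
    using u by (simp add: scaleR_add_right)
  ultimately show "c *\<^sub>R u \<in> rel_plus T S" unfolding rel_plus_def by blast
qed

lemma Domain_rel_plus: "Domain (rel_plus T S) = Domain T \<inter> Domain S"
  unfolding rel_plus_def by blast

lemma rel_plus_Image_0:
  fixes T S :: "('a::real_vector \<times> 'b::real_vector) set"
  assumes T: "subspace T" and S: "subspace S" and sub: "S `` {0} \<subseteq> T `` {0}"
  shows "rel_plus T S `` {0} = T `` {0}"
proof
  show "rel_plus T S `` {0} \<subseteq> T `` {0}"
    using sub subspace_add[OF subspace_Image_0[OF T]] unfolding rel_plus_def by blast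
  show "T `` {0} \<subseteq> rel_plus T S `` {0}"
    using subspace_0[OF S] unfolding rel_plus_def by (force simp: zero_prod_def)
qed

lemma rel_norm_infdist:
  assumes "normed_space_over sX" and "normed_space_over sY"
    and "T \<in> LR sX sY" and y: "(x, y) \<in> T"
  shows "rel_norm T x = infdist y (T `` {0})"
proof -
  have "0 \<in> T `` {0}" using LR_subspace[OF assms(1-3)] subspace_0 subspace_Image_0 by blast
  then have ne: "closure (T `` {0}) \<noteq> {}" by auto
  have "rel_norm T x = quot_norm (closure (T `` {0})) y"
    using rel_norm_eq[OF assms(1-3)] y by blast
  also have "\<dots> = infdist y (closure (T `` {0}))"
    using ne by (simp add: quot_norm_def infdist_notempty dist_norm setcompr_eq_image)
  also have "\<dots> = infdist y (T `` {0})"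
    by (metis infdist_eq_setdist setdist_closure_2)
  finally show ?thesis .
qed

text \<open>By linearity only the value at \<open>0\<close> matters: every nonempty \<open>T(x)\<close> is a translate of \<open>T(0)\<close>.\<close>

lemma closable_iff_Image_0:
  fixes T :: "('a::real_normed_vector \<times> 'b::real_normed_vector) set"
  assumes T: "subspace T"
  shows "closable T \<longleftrightarrow> closure T `` {0} \<subseteq> T `` {0}"
proof
  assume "closable T"
  moreover have "0 \<in> Domain T" using subspace_0[OF T] by (auto simp: zero_prod_def)
  ultimately show "closure T `` {0} \<subseteq> T `` {0}" by (simp add: closable_def)
next
  assume sub: "closure T `` {0} \<subseteq> T `` {0}"
  have "closure T `` {x} = T `` {x}" if "x \<in> Domain T" for x
  proof
    show "T `` {x} \<subseteq> closure T `` {x}" using closure_subset by blast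
    obtain y where y: "(x, y) \<in> T" using \<open>x \<in> Domain T\<close> by blast
    \<comment> \<open>The translation by \<open>- (x, y)\<close> maps \<open>T\<close> into itself and, being a homeomorphism, \<open>closure T\<close> too;
      it moves the points over \<open>x\<close> to points over \<open>0\<close>.\<close>
    have "(+) (- (x, y)) ` T \<subseteq> T"
      using subspace_add[OF T subspace_neg[OF T y]] by blast
    then have shift: "(+) (- (x, y)) ` closure T \<subseteq> closure T"
      using closure_mono closure_translation by metis
    show "closure T `` {x} \<subseteq> T `` {x}"
    proof
      fix w assume "w \<in> closure T `` {x}"
      then have "- (x, y) + (x, w) \<in> closure T" using shift by blast
      then have "(0, w - y) \<in> T" using sub by auto
      then show "w \<in> T `` {x}" using subspace_add[OF T _ y, of "(0, w - y)"] by simp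
    qed
  qed
  then show "closable T" by (simp add: closable_def)
qed

text \<open>
  Closability says that passing to the closure adds no points over the domain, so all that can
  keep a closable relation from being closed is a larger domain of its closure.
\<close>

lemma closed_iff_closable_Domain:
  "closed T \<longleftrightarrow> closable T \<and> Domain (closure T) = Domain T"
proof
  assume "closed T"
  then show "closable T \<and> Domain (closure T) = Domain T" by (simp add: closable_def)
next
  assume *: "closable T \<and> Domain (closure T) = Domain T"
  have "closure T \<subseteq> T"
  proof
    fix u assume u: "u \<in> closure T"
    obtain x y where xy: "u = (x, y)" by (cases u)
    then have "x \<in> Domain T" using u * by blast
    then have "closure T `` {x} = T `` {x}" using * by (simp add: closable_def)
    then show "u \<in> T" using u xy by blast
  qed
  then show "closed T" by (metis closure_subset closure_closed closed_closure subset_antisym)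
qed

lemma closed_Image_0:
  fixes T :: "('a::real_normed_vector \<times> 'b::real_normed_vector) set"
  assumes "subspace T" and "closable T"
  shows "closed (T `` {0})"
proof -
  have "T `` {0} = closure T `` {0}"
    using assms closure_subset[of T] by (auto simp: closable_iff_Image_0)
  also have "\<dots> = Pair 0 -` closure T" by auto
  also have "closed \<dots>" by (intro continuous_closed_vimage continuous_intros) auto
  finally show ?thesis .
qed

section \<open>Comparison of graph norms\<close>

text \<open>
  \<open>infdist q (Q(0))\<close> is the norm of \<open>Q(x)\<close> in the quotient by \<open>closure (Q(0))\<close> for any \<open>q \<in> Q(x)\<close>.
  So this says that \<open>P\<close> and \<open>Q\<close> have the same multivalued part and that \<open>Q\<close> is bounded with respect
  to the graph norm of \<open>P\<close>.
\<close>

definition graph_dominates ::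
  "('a::real_normed_vector \<times> 'b::real_normed_vector) set \<Rightarrow> ('a \<times> 'b) set \<Rightarrow> bool"
  where "graph_dominates P Q \<longleftrightarrow> Domain P \<subseteq> Domain Q \<and> P `` {0} = Q `` {0} \<and>
    (\<exists>C\<ge>0. \<forall>x p q. (x, p) \<in> P \<longrightarrow> (x, q) \<in> Q \<longrightarrow>
      infdist q (Q `` {0}) \<le> C * (norm x + infdist p (P `` {0})))"

text \<open>
  Completeness enters here.  The values of \<open>Q\<close> along a convergent sequence in \<open>P\<close> are Cauchy modulo
  \<open>Q(0)\<close> only; correcting each increment by an element of \<open>Q(0)\<close> that nearly attains the quotient
  norm makes the increments absolutely summable, provided that the sequence in \<open>P\<close> was chosen to
  converge geometrically.
\<close>

lemma graph_dominates_lift: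
  fixes P Q :: "('a::real_normed_vector \<times> 'b::banach) set"
  assumes P: "subspace P" and Q: "subspace Q" and dom: "graph_dominates P Q"
    and xp: "(x, p) \<in> closure P"
  obtains xs ps qs q where "\<And>n. (xs n, ps n) \<in> P" "\<And>n. (xs n, qs n) \<in> Q"
    "xs \<longlonglongrightarrow> x" "ps \<longlonglongrightarrow> p" "qs \<longlonglongrightarrow> q"
proof -
  define V where "V = Q `` {0}"
  have V: "subspace V" unfolding V_def using Q by (rule subspace_Image_0)
  have PV: "P `` {0} = V" and DPQ: "Domain P \<subseteq> Domain Q"
    using dom by (simp_all add: graph_dominates_def V_def)
  obtain C where C: "C \<ge> 0"
    and bound: "\<And>x p q. (x, p) \<in> P \<Longrightarrow> (x, q) \<in> Q \<Longrightarrow> infdist q V \<le> C * (norm x + infdist p V)"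
    using dom unfolding graph_dominates_def by (auto simp: V_def)
  \<comment> \<open>The rate \<open>(1/2) ^ n\<close> bounds each of the four distances to the limit that enter an increment of
    the pair \<open>(xs, ps)\<close>, whence the constant \<open>4 * C\<close> below; the additional \<open>1\<close> gives the strict
    inequality needed to approximate the infimum.\<close>
  have "\<exists>u\<in>P. dist u (x, p) < (1/2) ^ n" for n :: nat
    using xp by (simp add: closure_approachable)
  then obtain us where us: "\<And>n. us n \<in> P" "\<And>n. dist (us n) (x, p) < (1/2) ^ n" by metis
  define xs ps where "xs = fst \<circ> us" and "ps = snd \<circ> us"
  have in_P: "(xs n, ps n) \<in> P" for n using us(1)[of n] by (simp add: xs_def ps_def)
  have dx: "norm (xs n - x) < (1/2) ^ n" and dp: "norm (ps n - p) < (1/2) ^ n" for n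
    using us(2)[of n] dist_fst_le[of "us n" "(x, p)"] dist_snd_le[of "us n" "(x, p)"]
    by (simp_all add: xs_def ps_def dist_norm)
  have half: "(\<lambda>n. (1/2 :: real) ^ n) \<longlonglongrightarrow> 0" by (intro LIMSEQ_power_zero) simp
  have xs: "xs \<longlonglongrightarrow> x"
    using dx by (intro Lim_transform_bound[OF _ half, THEN LIM_zero_cancel])
      (auto intro!: always_eventually less_imp_le)
  have ps: "ps \<longlonglongrightarrow> p"
    using dp by (intro Lim_transform_bound[OF _ half, THEN LIM_zero_cancel])
      (auto intro!: always_eventually less_imp_le)
  have "\<exists>q. (xs n, q) \<in> Q" for n using in_P[of n] DPQ by blast
  then obtain qs where qs: "\<And>n. (xs n, qs n) \<in> Q" by metis
  have small: "infdist (qs (Suc n) - qs n) V < (4 * C + 1) * (1/2) ^ n" for n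
  proof -
    have "(xs (Suc n) - xs n, ps (Suc n) - ps n) \<in> P" "(xs (Suc n) - xs n, qs (Suc n) - qs n) \<in> Q"
      using subspace_diff[OF P in_P in_P, of "Suc n" n] subspace_diff[OF Q qs qs, of "Suc n" n]
      by simp_all
    then have "infdist (qs (Suc n) - qs n) V
        \<le> C * (norm (xs (Suc n) - xs n) + infdist (ps (Suc n) - ps n) V)" by (rule bound)
    also have "\<dots> \<le> C * (4 * (1/2) ^ n)"
    proof (intro mult_left_mono C)
      have pow: "(1/2 :: real) ^ Suc n \<le> (1/2) ^ n" by simp
      have "norm (xs (Suc n) - xs n) \<le> norm (xs (Suc n) - x) + norm (xs n - x)"
        using norm_triangle_ineq4[of "xs (Suc n) - x" "xs n - x"] by simp
      moreover have "norm (ps (Suc n) - ps n) \<le> norm (ps (Suc n) - p) + norm (ps n - p)"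
        using norm_triangle_ineq4[of "ps (Suc n) - p" "ps n - p"] by simp
      ultimately show "norm (xs (Suc n) - xs n) + infdist (ps (Suc n) - ps n) V \<le> 4 * (1/2) ^ n"
        using dx[of n] dx[of "Suc n"] dp[of n] dp[of "Suc n"] pow
          infdist_subspace_le_norm[OF V, of "ps (Suc n) - ps n"] by linarith
    qed
    also have "\<dots> < (4 * C + 1) * (1/2) ^ n" by (simp add: algebra_simps)
    finally show ?thesis .
  qed
  have "\<exists>v\<in>V. dist (qs (Suc n) - qs n) v < (4 * C + 1) * (1/2) ^ n" for n
    using infdist_approx[OF small[of n]] subspace_0[OF V] by blast
  then obtain vs where vs: "\<And>n. vs n \<in> V"
    "\<And>n. norm (qs (Suc n) - qs n - vs n) < (4 * C + 1) * (1/2) ^ n"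
    unfolding dist_norm by metis
  define rs where "rs n = qs n - (\<Sum>k<n. vs k)" for n
  have rs_Q: "(xs n, rs n) \<in> Q" for n
  proof -
    have "(0, \<Sum>k<n. vs k) \<in> Q"
      using subspace_sum[OF V, of "{..<n}" vs] vs(1) by (simp add: V_def)
    from subspace_diff[OF Q qs[of n] this] show ?thesis by (simp add: rs_def)
  qed
  have "summable (\<lambda>n. rs (Suc n) - rs n)"
  proof (rule summable_comparison_test)
    show "\<exists>N. \<forall>n\<ge>N. norm (rs (Suc n) - rs n) \<le> (4 * C + 1) * (1/2) ^ n"
    proof (intro exI allI impI)
      fix n
      have "rs (Suc n) - rs n = qs (Suc n) - qs n - vs n" by (simp add: rs_def algebra_simps)
      then show "norm (rs (Suc n) - rs n) \<le> (4 * C + 1) * (1/2) ^ n"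
        using less_imp_le[OF vs(2)[of n]] by simp
    qed
    show "summable (\<lambda>n. (4 * C + 1) * (1/2) ^ n)"
      by (intro summable_mult summable_geometric) simp
  qed
  then have "(\<lambda>n. \<Sum>k<n. rs (Suc k) - rs k) \<longlonglongrightarrow> (\<Sum>k. rs (Suc k) - rs k)"
    by (rule summable_LIMSEQ)
  then have "(\<lambda>n. rs n - rs 0) \<longlonglongrightarrow> (\<Sum>k. rs (Suc k) - rs k)"
    by (simp add: sum_lessThan_telescope)
  from tendsto_add[OF this tendsto_const[of "rs 0"]]
  obtain q where "rs \<longlonglongrightarrow> q" by auto
  with in_P rs_Q xs ps show thesis by (rule that)
qed

lemma graph_dominates_Domain_closure:
  fixes P Q :: "('a::real_normed_vector \<times> 'b::banach) set"
  assumes "subspace P" and "subspace Q" and "graph_dominates P Q"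
  shows "Domain (closure P) \<subseteq> Domain (closure Q)"
proof
  fix x assume "x \<in> Domain (closure P)"
  then obtain p where "(x, p) \<in> closure P" by blast
  from graph_dominates_lift[OF assms this] obtain xs qs q where
    "\<And>n. (xs n, qs n) \<in> Q" "xs \<longlonglongrightarrow> x" "qs \<longlonglongrightarrow> q" by metis
  then have "(x, q) \<in> closure Q"
    unfolding closure_sequential
    by (intro exI[of _ "\<lambda>n. (xs n, qs n)"]) (auto intro: tendsto_Pair)
  then show "x \<in> Domain (closure Q)" by blast
qed

text \<open>
  The first domination lifts a sequence of \<open>P\<close> over a null sequence to a convergent one of \<open>Q\<close>;
  its limit lies in \<open>Q(0)\<close>, so the quotient norms tend to \<open>0\<close>.  The second domination carries this
  back to \<open>P\<close>.
\<close>

lemma graph_dominates_closable: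
  fixes P Q :: "('a::real_normed_vector \<times> 'b::banach) set"
  assumes P: "subspace P" and Q: "subspace Q"
    and PQ: "graph_dominates P Q" and QP: "graph_dominates Q P" and cl: "closable Q"
  shows "closable P"
proof -
  define V where "V = Q `` {0}"
  have PV: "P `` {0} = V" using PQ by (simp add: graph_dominates_def V_def)
  have V: "subspace V" unfolding V_def using Q by (rule subspace_Image_0)
  have clV: "closed V" unfolding V_def using Q cl by (rule closed_Image_0)
  obtain C where
    bound: "\<And>x p q. (x, p) \<in> P \<Longrightarrow> (x, q) \<in> Q \<Longrightarrow> infdist p V \<le> C * (norm x + infdist q V)"
    using QP unfolding graph_dominates_def PV V_def[symmetric] by blast
  have "p \<in> V" if "(0, p) \<in> closure P" for p
  proof -
    obtain xs ps qs q where in_P: "\<And>n. (xs n, ps n) \<in> P" and in_Q: "\<And>n. (xs n, qs n) \<in> Q"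
      and lim: "xs \<longlonglongrightarrow> 0" "ps \<longlonglongrightarrow> p" "qs \<longlonglongrightarrow> q"
      using graph_dominates_lift[OF P Q PQ \<open>(0, p) \<in> closure P\<close>] by metis
    have "(0, q) \<in> closure Q"
      unfolding closure_sequential
      using in_Q lim by (intro exI[of _ "\<lambda>n. (xs n, qs n)"]) (auto intro: tendsto_Pair)
    then have "q \<in> V" using cl by (auto simp: closable_iff_Image_0[OF Q] V_def)
    have "(\<lambda>n. C * (norm (xs n) + infdist (qs n) V)) \<longlonglongrightarrow> C * (norm (0::'a) + infdist q V)"
      using lim by (intro tendsto_intros)
    moreover have "(\<lambda>n. infdist (ps n) V) \<longlonglongrightarrow> infdist p V"
      using lim by (intro tendsto_intros)
    ultimately have "infdist p V \<le> C * (norm (0::'a) + infdist q V)"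
      using bound[OF in_P in_Q] by (meson LIMSEQ_le)
    then have "infdist p V = 0" using \<open>q \<in> V\<close> infdist_nonneg[of p V] by simp
    then show "p \<in> V"
      using in_closed_iff_infdist_zero[OF clV, of p] subspace_0[OF V] by blast
  qed
  then show ?thesis using PV by (auto simp: closable_iff_Image_0[OF P])
qed

section \<open>Perturbation by a relation of small relative bound\<close>

lemma rel_bound_lessE:
  assumes "rel_bounded T S" and "rel_bound T S < c"
  obtains a b where "a \<ge> 0" "b \<ge> 0" "b < c"
    "\<And>x. x \<in> Domain T \<Longrightarrow> rel_norm S x \<le> a * norm x + b * rel_norm T x"
proof -
  let ?B = "{b. b \<ge> 0 \<and> (\<exists>a\<ge>0. \<forall>x\<in>Domain T. rel_norm S x \<le> a * norm x + b * rel_norm T x)}"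
  obtain c0 where "c0 \<ge> 0" "\<forall>x\<in>Domain T. rel_norm S x \<le> c0 * (norm x + rel_norm T x)"
    using assms(1) by (auto simp: rel_bounded_def)
  then have "c0 \<in> ?B" by (auto simp: distrib_left intro!: exI[of _ c0])
  moreover have "bdd_below ?B" by (rule bdd_belowI[of _ 0]) simp
  ultimately have "\<exists>b\<in>?B. b < c"
    using assms(2) cInf_less_iff[of ?B c] unfolding rel_bound_def by blast
  then show thesis using that by blast
qed

text \<open>
  With \<open>d\<close> the distance to \<open>V = T(0)\<close>, the two directions rest on
  \<open>d(y + z) \<le> d(y) + d(z)\<close> and \<open>d(y) \<le> d(y + z) + d(z)\<close> for \<open>y \<in> T(x)\<close> and \<open>z \<in> S(x)\<close>, where
  \<open>d(z) \<le> a \<parallel>x\<parallel> + b d(y)\<close>.  In the second the term \<open>b d(y)\<close> is absorbed on the left, which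
  leaves a positive multiple of \<open>d(y)\<close> only because \<open>b < 1\<close>.
\<close>

lemma rel_plus_graph_dominates:
  fixes sX :: "'k::real_normed_field \<Rightarrow> 'a::real_normed_vector \<Rightarrow> 'a"
    and sY :: "'k \<Rightarrow> 'b::real_normed_vector \<Rightarrow> 'b"
  assumes nX: "normed_space_over sX" and nY: "normed_space_over sY"
    and T: "T \<in> LR sX sY" and S: "S \<in> LR sX sY"
    and D: "Domain T \<subseteq> Domain S" and ST: "S `` {0} \<subseteq> T `` {0}"
    and bdd: "rel_bounded T S" and less: "rel_bound T S < 1"
  shows "graph_dominates T (rel_plus T S)" "graph_dominates (rel_plus T S) T"
proof -
  have sT: "subspace T" and sS: "subspace S"
    using LR_subspace[OF nX nY] T S by blast+
  define V where "V = T `` {0}"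
  have V: "subspace V" unfolding V_def using sT by (rule subspace_Image_0)
  have plus0: "rel_plus T S `` {0} = V"
    using rel_plus_Image_0[OF sT sS ST] by (simp add: V_def)
  have dom: "Domain (rel_plus T S) = Domain T" using D by (auto simp: Domain_rel_plus)
  obtain a b where a: "a \<ge> 0" and b: "b \<ge> 0" "b < 1"
    and ab: "\<And>x. x \<in> Domain T \<Longrightarrow> rel_norm S x \<le> a * norm x + b * rel_norm T x"
    using rel_bound_lessE[OF bdd less] by blast
  have est: "infdist q V \<le> a * norm x + (1 + b) * infdist p V \<and>
      (1 - b) * infdist p V \<le> a * norm x + infdist q V"
    if p: "(x, p) \<in> T" and q: "(x, q) \<in> rel_plus T S" for x p q
  proof -
    obtain y z where yz: "q = y + z" "(x, y) \<in> T" "(x, z) \<in> S"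
      using q unfolding rel_plus_def by blast
    have "infdist y V = infdist p V"
      using subspace_Image_diff[OF sT yz(2) p] by (intro infdist_subspace_cong[OF V]) (simp add: V_def)
    moreover have "infdist z V \<le> a * norm x + b * infdist p V"
    proof -
      \<comment> \<open>The given bound concerns the quotient by \<open>S(0)\<close>; as \<open>S(0) \<subseteq> V\<close>, passing to the quotient
        by \<open>V\<close> only decreases the norm of \<open>S(x)\<close>.\<close>
      have "infdist z V \<le> infdist z (S `` {0})"
        using ST subspace_0[OF subspace_Image_0[OF sS]] unfolding V_def by (intro infdist_mono) auto
      also have "\<dots> = rel_norm S x" using rel_norm_infdist[OF nX nY S yz(3)] by simp
      also have "\<dots> \<le> a * norm x + b * rel_norm T x" using p by (intro ab) blast
      also have "rel_norm T x = infdist p V"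
        using rel_norm_infdist[OF nX nY T p] by (simp add: V_def)
      finally show ?thesis .
    qed
    moreover have "infdist q V \<le> infdist y V + infdist z V"
      unfolding yz(1) by (rule infdist_subspace_add[OF V])
    moreover have "infdist y V \<le> infdist q V + infdist z V"
      using infdist_subspace_add[OF V, of q "- z"] by (simp add: yz(1) infdist_subspace_minus[OF V])
    ultimately show ?thesis by (simp add: algebra_simps)
  qed
  have "infdist q V \<le> (a + 1 + b) * (norm x + infdist p V)"
    if "(x, p) \<in> T" "(x, q) \<in> rel_plus T S" for x p q
  proof -
    have "0 \<le> a * infdist p V" "0 \<le> (1 + b) * norm x"
      using a b by (simp_all add: infdist_nonneg)
    then show ?thesis using est[OF that] by (simp add: algebra_simps)
  qed
  then show "graph_dominates T (rel_plus T S)"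
    unfolding graph_dominates_def plus0 dom V_def[symmetric]
    using a b by (auto intro!: exI[of _ "a + 1 + b"])
  have "infdist p V \<le> (a + 1) / (1 - b) * (norm x + infdist q V)"
    if "(x, q) \<in> rel_plus T S" "(x, p) \<in> T" for x p q
  proof -
    have "0 \<le> a * infdist q V" using a by (simp add: infdist_nonneg)
    moreover have "(a + 1) * (norm x + infdist q V)
        = a * norm x + infdist q V + norm x + a * infdist q V" by (simp add: algebra_simps)
    ultimately have "(1 - b) * infdist p V \<le> (a + 1) * (norm x + infdist q V)"
      using est[OF that(2,1)] norm_ge_zero[of x] by linarith
    then show ?thesis using b by (simp add: pos_le_divide_eq mult.commute)
  qed
  then show "graph_dominates (rel_plus T S) T"
    unfolding graph_dominates_def plus0 dom V_def[symmetric]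
    using a b by (auto intro!: exI[of _ "(a + 1) / (1 - b)"])
qed

theorem theorem6p3:
  fixes sX :: "'k::real_normed_field \<Rightarrow> 'a::real_normed_vector \<Rightarrow> 'a"
    and sY :: "'k \<Rightarrow> 'b::banach \<Rightarrow> 'b"
    and T S :: "('a \<times> 'b) set"
  assumes "normed_space_over sX" and "normed_space_over sY"
    and "T \<in> LR sX sY" and "S \<in> LR sX sY"
    and "Domain T \<subseteq> Domain S"
    and "S `` {0} \<subseteq> T `` {0}"
    and "rel_bounded T S"
    and "rel_bound T S < 1"
  shows "(closed (rel_plus T S) \<longleftrightarrow> closed T) \<and>
         (closable (rel_plus T S) \<longleftrightarrow> closable T) \<and>
         Domain (closure (rel_plus T S)) = Domain (closure T)"
proof -
  have T: "subspace T" and TS: "subspace (rel_plus T S)"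
    using LR_subspace[OF assms(1,2)] assms(3,4) by (auto intro: subspace_rel_plus)
  note dom = rel_plus_graph_dominates[OF assms]
  have closable: "closable (rel_plus T S) \<longleftrightarrow> closable T"
    using graph_dominates_closable[OF T TS dom] graph_dominates_closable[OF TS T dom(2,1)] by blast
  have Domain: "Domain (closure (rel_plus T S)) = Domain (closure T)"
    using graph_dominates_Domain_closure[OF T TS dom(1)]
      graph_dominates_Domain_closure[OF TS T dom(2)] by blast
  have "Domain (rel_plus T S) = Domain T" using assms(5) by (auto simp: Domain_rel_plus)
  with closable Domain show ?thesis by (simp add: closed_iff_closable_Domain)
qed

end
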